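(* Let $d\ge1$, let $\mathcal{W}_1,\dots,\mathcal{W}_d$ be finite nonempty sets, let $\lambda_1,\dots,\lambda_d>0$ and $\lambda_{d+1}:=0$, and let $\mathsf{s}=(x_1,\dots,x_n)\in\mathcal{X}^n$ be a fixed tuple of training instances. With the losses $\ell_k(w_1^k,\mathsf{s})$ of the hierarchical model described in the context, define for $1\le k\le d$ $$P^{*}_{W_k|W_1^{k-1}}(w_k|w_1^{k-1}):=\frac{\exp\left(-\ell_k(w_1^k,\mathsf{s})/\lambda_k\right)}{\sum_{w_k'\in\mathcal{W}_k}\exp\left(-\ell_k(w_1^{k-1}w_k',\mathsf{s})/\lambda_k\right)},\qquad P^{*}_{\mathsf{W}}:=P^{*}_{W_1}P^{*}_{W_2|W_1}\cdots P^{*}_{W_d|W_1^{d-1}},$$ $$\overline{\ell}_k(w_1^{k-1},\mathsf{s}):=-\lambda_k\log\left(\frac{1}{|\mathcal{W}_k|}\sum_{w_k'\in\mathcal{W}_k}\exp\left(-\frac{\ell_k(w_1^{k-1}w_k',\mathsf{s})}{\lambda_k}\right)\right),$$ $$\ell^{(\lambda)}(\mathsf{w},\mathsf{s}):=\sum_{k=1}^d\left(\ell_k(w_1^k,\mathsf{s})-\overline{\ell}_k(w_1^{k-1},\mathsf{s})\right).$$ Then $$P^{*}_{\mathsf{W}}=\operatorname*{arg\,min}_{P_{\mathsf{W}}}\left\{\mathbb{E}\left[\ell^{(\lambda)}(\mathsf{W},\mathsf{s})\right]-\sum_{k=1}^d(\lambda_k-\lambda_{k+1})H(W_1^k)\right\},$$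 where the minimum is over all probability distributions $P_{\mathsf{W}}$ on $\mathcal{W}_1\times\dots\times\mathcal{W}_d$, $\mathsf{W}=(W_1,\dots,W_d)\sim P_{\mathsf{W}}$, and $W_1^k=(W_1,\dots,W_k)$.
   Context: Here $H$ is the Shannon entropy $H(X)=-\sum_a P_X(a)\log P_X(a)$ with natural logarithm. Notation: $\mathsf{w}=(w_1,\dots,w_d)$, $w_1^k=(w_1,\dots,w_k)$, and $w_1^{k-1}w_k'=(w_1,\dots,w_{k-1},w_k')$. Model. Let $\varepsilon>0$, $\beta>1$, $R:=\varepsilon\beta^d$, $\gamma_k:=\beta^{k-d}$ for $0\le k\le d$, $\mathcal{X}:=\{x\in\mathbb{R}:\varepsilon\le|x|<R\}$, and $\mathcal{X}_k:=\{x\in\mathbb{R}:R\gamma_{k-1}\le|x|<R\gamma_k\}$ for $1\le k\le d$, so $\mathcal{X}=\bigcup_{k=1}^d\mathcal{X}_k$ (disjoint). The target function $f:(-R,R)\to\mathbb{R}$ satisfies $f(0)=0$ and is an $(M_1,M_2)$-diffeomorphism: it is invertible onto its image, and $f$ and $f^{-1}$ are twice differentiable, $M_1$-Lipschitz, and have $M_2$-Lipschitz derivatives. For each $k$ and each $w_k\in\mathcal{W}_k$ a function $\mathcal{F}(\cdot,w_k):\mathbb{R}\to\mathbb{R}$ is given. For $x\in(-R,R)$, set $h_0(x):=f_{[\gamma_0]}(x)=f(\gamma_0x)/\gamma_0$ and $h_k(x):=h_{k-1}(x)+\mathcal{F}(h_{k-1}(x),w_k)$ for $1\le k\le d$, so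 $h_k$ depends on $w_1^k$. Losses. For $1\le k\le d$, $\ell_k(w_1^k,x):=\left|\gamma_kh_k(x/\gamma_k)-f(x)\right|$ if $x\in\mathcal{X}_k$ and $\ell_k(w_1^k,x):=0$ if $x\in\mathcal{X}\setminus\mathcal{X}_k$; and $\ell_k(w_1^k,\mathsf{s}):=\frac1n\sum_{i=1}^n\ell_k(w_1^k,x_i)$. *)

theory Defs
  imports "HOL-Probability.Probability"
begin

subsection \<open>The hierarchical model\<close>

definition radius :: "real \<Rightarrow> real \<Rightarrow> nat \<Rightarrow> real" where
  "radius \<epsilon> \<beta> d = \<epsilon> * \<beta> ^ d"

definition gam :: "real \<Rightarrow> nat \<Rightarrow> nat \<Rightarrow> real" where
  "gam \<beta> d k = \<beta> powi (int k - int d)"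

definition instance_space :: "real \<Rightarrow> real \<Rightarrow> nat \<Rightarrow> real set" where
  "instance_space \<epsilon> \<beta> d = {x. \<epsilon> \<le> \<bar>x\<bar> \<and> \<bar>x\<bar> < radius \<epsilon> \<beta> d}"

definition shell :: "real \<Rightarrow> real \<Rightarrow> nat \<Rightarrow> nat \<Rightarrow> real set" where
  "shell \<epsilon> \<beta> d k =
     {x. radius \<epsilon> \<beta> d * gam \<beta> d (k - 1) \<le> \<bar>x\<bar> \<and> \<bar>x\<bar> < radius \<epsilon> \<beta> d * gam \<beta> d k}"

text \<open>
  For open \<open>S\<close> the image \<open>f ` S\<close> below is open as well (invariance of domain), so
  \<^const>\<open>deriv\<close> of the inverse is the usual derivative at every point of \<open>f ` S\<close>.
\<close>

definition smooth_on :: "real \<Rightarrow> real \<Rightarrow> real set \<Rightarrow> (real \<Rightarrow> real) \<Rightarrow> bool" where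
  "smooth_on M1 M2 S g \<longleftrightarrow>
     g differentiable_on S \<and> deriv g differentiable_on S \<and>
     M1-lipschitz_on S g \<and> M2-lipschitz_on S (deriv g)"

definition diffeomorphism_on :: "real \<Rightarrow> real \<Rightarrow> real set \<Rightarrow> (real \<Rightarrow> real) \<Rightarrow> bool" where
  "diffeomorphism_on M1 M2 S f \<longleftrightarrow>
     inj_on f S \<and> smooth_on M1 M2 S f \<and> smooth_on M1 M2 (f ` S) (the_inv_into S f)"

text \<open>
  A weight tuple is a function \<open>w\<close> on indices, of which only \<open>w 1, \<dots>, w d\<close> matter; the
  prefix notation $w_1^{k-1} w_k'$ becomes the update \<open>w(k := w')\<close>. Quantities
  that depend on the prefix $w_1^k$ only are given the whole of \<open>w\<close>.
\<close>

primrec hier ::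
  "real \<Rightarrow> (real \<Rightarrow> real) \<Rightarrow> (nat \<Rightarrow> real \<Rightarrow> 'w \<Rightarrow> real) \<Rightarrow> (nat \<Rightarrow> 'w) \<Rightarrow> nat \<Rightarrow> real \<Rightarrow> real" where
  "hier \<gamma>0 f F w 0 x = f (\<gamma>0 * x) / \<gamma>0"
| "hier \<gamma>0 f F w (Suc k) x = hier \<gamma>0 f F w k x + F (Suc k) (hier \<gamma>0 f F w k x) (w (Suc k))"

lemma hier_prefix:
  assumes "\<And>j. 1 \<le> j \<Longrightarrow> j \<le> k \<Longrightarrow> w j = w' j"
  shows "hier \<gamma>0 f F w k x = hier \<gamma>0 f F w' k x"
  using assms by (induction k) auto

definition instance_loss ::
  "real \<Rightarrow> real \<Rightarrow> nat \<Rightarrow> (real \<Rightarrow> real) \<Rightarrow> (nat \<Rightarrow> real \<Rightarrow> 'w \<Rightarrow> real)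
    \<Rightarrow> nat \<Rightarrow> (nat \<Rightarrow> 'w) \<Rightarrow> real \<Rightarrow> real" where
  "instance_loss \<epsilon> \<beta> d f F k w x =
     (if x \<in> shell \<epsilon> \<beta> d k
      then \<bar>gam \<beta> d k * hier (gam \<beta> d 0) f F w k (x / gam \<beta> d k) - f x\<bar>
      else 0)"

definition sample_loss ::
  "real \<Rightarrow> real \<Rightarrow> nat \<Rightarrow> (real \<Rightarrow> real) \<Rightarrow> (nat \<Rightarrow> real \<Rightarrow> 'w \<Rightarrow> real)
    \<Rightarrow> nat \<Rightarrow> (nat \<Rightarrow> real) \<Rightarrow> nat \<Rightarrow> (nat \<Rightarrow> 'w) \<Rightarrow> real" where
  "sample_loss \<epsilon> \<beta> d f F n s k w = (1 / real n) * (\<Sum>i=1..n. instance_loss \<epsilon> \<beta> d f F k w (s i))"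

lemma sample_loss_prefix:
  assumes "\<And>j. 1 \<le> j \<Longrightarrow> j \<le> k \<Longrightarrow> w j = w' j"
  shows "sample_loss \<epsilon> \<beta> d f F n s k w = sample_loss \<epsilon> \<beta> d f F n s k w'"
proof -
  have eq: "hier \<gamma>0 f F w k x = hier \<gamma>0 f F w' k x" for \<gamma>0 x
    by (rule hier_prefix) (rule assms)
  show ?thesis
    unfolding sample_loss_def instance_loss_def eq ..
qed


subsection \<open>Gibbs distributions and the multiscale loss\<close>

text \<open>In the following, \<open>L k w\<close> stands for the loss $\ell_k(w_1^k, \mathsf{s})$.\<close>

definition tuples :: "nat \<Rightarrow> (nat \<Rightarrow> 'w set) \<Rightarrow> (nat \<Rightarrow> 'w) set" where
  "tuples d W = PiE {1..d} W"

definition gibbs_cond ::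
  "(nat \<Rightarrow> 'w set) \<Rightarrow> (nat \<Rightarrow> real) \<Rightarrow> (nat \<Rightarrow> (nat \<Rightarrow> 'w) \<Rightarrow> real) \<Rightarrow> nat \<Rightarrow> (nat \<Rightarrow> 'w) \<Rightarrow> real" where
  "gibbs_cond W lam L k w =
     exp (- L k w / lam k) / (\<Sum>w'\<in>W k. exp (- L k (w(k := w')) / lam k))"

definition gibbs ::
  "nat \<Rightarrow> (nat \<Rightarrow> 'w set) \<Rightarrow> (nat \<Rightarrow> real) \<Rightarrow> (nat \<Rightarrow> (nat \<Rightarrow> 'w) \<Rightarrow> real) \<Rightarrow> (nat \<Rightarrow> 'w) pmf" where
  "gibbs d W lam L =
     embed_pmf (\<lambda>w. if w \<in> tuples d W then \<Prod>k=1..d. gibbs_cond W lam L k w else 0)"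

definition soft_loss ::
  "(nat \<Rightarrow> 'w set) \<Rightarrow> (nat \<Rightarrow> real) \<Rightarrow> (nat \<Rightarrow> (nat \<Rightarrow> 'w) \<Rightarrow> real) \<Rightarrow> nat \<Rightarrow> (nat \<Rightarrow> 'w) \<Rightarrow> real" where
  "soft_loss W lam L k w =
     - lam k * ln (1 / real (card (W k)) * (\<Sum>w'\<in>W k. exp (- L k (w(k := w')) / lam k)))"

definition multiscale_loss ::
  "nat \<Rightarrow> (nat \<Rightarrow> 'w set) \<Rightarrow> (nat \<Rightarrow> real) \<Rightarrow> (nat \<Rightarrow> (nat \<Rightarrow> 'w) \<Rightarrow> real) \<Rightarrow> (nat \<Rightarrow> 'w) \<Rightarrow> real" where
  "multiscale_loss d W lam L w = (\<Sum>k=1..d. L k w - soft_loss W lam L k w)"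

text \<open>Shannon entropy in nats of a finitely supported distribution.\<close>

definition shannon_entropy :: "'a pmf \<Rightarrow> real" where
  "shannon_entropy p = - (\<Sum>a\<in>set_pmf p. pmf p a * ln (pmf p a))"

definition prefix_pmf :: "nat \<Rightarrow> (nat \<Rightarrow> 'w) pmf \<Rightarrow> (nat \<Rightarrow> 'w) pmf" where
  "prefix_pmf k P = map_pmf (\<lambda>w. restrict w {1..k}) P"

definition multiscale_objective ::
  "nat \<Rightarrow> (nat \<Rightarrow> 'w set) \<Rightarrow> (nat \<Rightarrow> real) \<Rightarrow> (nat \<Rightarrow> (nat \<Rightarrow> 'w) \<Rightarrow> real) \<Rightarrow> (nat \<Rightarrow> 'w) pmf \<Rightarrow> real" where
  "multiscale_objective d W lam L P =
     measure_pmf.expectation P (multiscale_loss d W lam L)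
     - (\<Sum>k=1..d. (lam k - lam (k + 1)) * shannon_entropy (prefix_pmf k P))"


subsection \<open>Sanity checks\<close>

text \<open>The function embedded in \<^const>\<open>gibbs\<close> is a probability mass function.\<close>

lemma gibbs_cond_sum:
  assumes "finite (W k)" "W k \<noteq> {}"
  shows "(\<Sum>a\<in>W k. gibbs_cond W lam L k (w(k := a))) = 1"
proof -
  have "(\<Sum>a\<in>W k. exp (- L k (w(k := a)) / lam k)) > 0"
    using assms by (intro sum_pos) auto
  then show ?thesis
    by (simp add: gibbs_cond_def flip: sum_divide_distrib)
qed

lemma sum_gibbs_weights:
  assumes fin: "\<And>k. k \<in> {1..d} \<Longrightarrow> finite (W k)"
    and ne: "\<And>k. k \<in> {1..d} \<Longrightarrow> W k \<noteq> {}"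
    and pre: "\<And>k w w'. (\<And>j. 1 \<le> j \<Longrightarrow> j \<le> k \<Longrightarrow> w j = w' j) \<Longrightarrow> L k w = L k w'"
  shows "(\<Sum>w\<in>tuples d W. \<Prod>k=1..d. gibbs_cond W lam L k w) = 1"
  using fin ne
proof (induction d)
  case 0
  then show ?case by (simp add: tuples_def)
next
  case (Suc d)
  let ?p = "\<lambda>d w. \<Prod>k=1..d. gibbs_cond W lam L k w"
  have eq: "tuples (Suc d) W = (\<lambda>(a, w). w(Suc d := a)) ` (W (Suc d) \<times> tuples d W)"
    unfolding tuples_def atLeastAtMostSuc_conv[of 1 d, OF le_add1[of 1 d, unfolded plus_1_eq_Suc]]
    by (rule PiE_insert_eq)
  have inj: "inj_on (\<lambda>(a, w). w(Suc d := a)) (W (Suc d) \<times> tuples d W)"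
    unfolding tuples_def by (rule inj_combinator) simp
  have low: "gibbs_cond W lam L k (w(Suc d := a)) = gibbs_cond W lam L k w"
    if "k \<in> {1..d}" for k w a
  proof -
    have "L k (w(Suc d := a)) = L k w"
      by (rule pre) (use that in auto)
    moreover have "L k ((w(Suc d := a))(k := b)) = L k (w(k := b))" for b
      by (rule pre) (use that in auto)
    ultimately show ?thesis
      by (simp add: gibbs_cond_def)
  qed
  have "(\<Sum>w\<in>tuples (Suc d) W. ?p (Suc d) w)
      = (\<Sum>(a, w)\<in>W (Suc d) \<times> tuples d W. ?p (Suc d) (w(Suc d := a)))"
    unfolding eq by (subst sum.reindex[OF inj]) (simp add: case_prod_unfold comp_def)
  also have "\<dots> = (\<Sum>a\<in>W (Suc d). \<Sum>w\<in>tuples d W. ?p (Suc d) (w(Suc d := a)))"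
    by (rule sum.cartesian_product[symmetric])
  also have "\<dots> = (\<Sum>w\<in>tuples d W. \<Sum>a\<in>W (Suc d). ?p (Suc d) (w(Suc d := a)))"
    by (rule sum.swap)
  also have "\<dots> = (\<Sum>w\<in>tuples d W. \<Sum>a\<in>W (Suc d).
                     ?p d w * gibbs_cond W lam L (Suc d) (w(Suc d := a)))"
    by (intro sum.cong refl) (simp add: low)
  also have "\<dots> = (\<Sum>w\<in>tuples d W. ?p d w)"
    using gibbs_cond_sum[of W "Suc d"] Suc.prems by (simp flip: sum_distrib_left)
  also have "\<dots> = 1"
    using Suc.IH Suc.prems by simp
  finally show ?case .
qed

lemma pmf_gibbs:
  assumes fin: "\<And>k. k \<in> {1..d} \<Longrightarrow> finite (W k)"
    and ne: "\<And>k. k \<in> {1..d} \<Longrightarrow> W k \<noteq> {}"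
    and pre: "\<And>k w w'. (\<And>j. 1 \<le> j \<Longrightarrow> j \<le> k \<Longrightarrow> w j = w' j) \<Longrightarrow> L k w = L k w'"
  shows "pmf (gibbs d W lam L) w =
    (if w \<in> tuples d W then \<Prod>k=1..d. gibbs_cond W lam L k w else 0)"
  unfolding gibbs_def
proof (rule pmf_embed_pmf)
  let ?q = "\<lambda>w. if w \<in> tuples d W then \<Prod>k=1..d. gibbs_cond W lam L k w else 0"
  show nn: "0 \<le> ?q w" for w
    by (auto simp: gibbs_cond_def intro!: prod_nonneg divide_nonneg_nonneg sum_nonneg)
  have f: "finite (tuples d W)"
    unfolding tuples_def using fin by (intro finite_PiE) auto
  have "(\<integral>\<^sup>+w. ennreal (?q w) \<partial>count_space UNIV) = (\<Sum>w\<in>tuples d W. ennreal (?q w))"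
    by (rule nn_integral_count_space'[OF f]) auto
  also have "\<dots> = ennreal (\<Sum>w\<in>tuples d W. ?q w)"
    by (rule sum_ennreal) (rule nn)
  also have "(\<Sum>w\<in>tuples d W. ?q w) = 1"
    by (subst sum_gibbs_weights[of d W L lam, OF fin ne pre, symmetric]) auto
  finally show "(\<integral>\<^sup>+w. ennreal (?q w) \<partial>count_space UNIV) = 1"
    by simp
qed

end

theory Submission
  imports Defs
begin

text \<open>
  Up to an additive constant, $\ell_k - \overline{\ell}_k$ is $-\lambda_k \log P^*_{W_k|W_1^{k-1}}$.
  Summation by parts turns the weighted entropies into conditional entropies weighted by
  $\lambda_k$, so the objective is a constant plus $\sum_k \lambda_k D_k$, where $D_k$ is the
  relative entropy of $P_{W_1^k}$ with respect to $P_{W_1^{k-1}} P^*_{W_k|W_1^{k-1}}$. Each $D_k$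
  is nonnegative, and they all vanish exactly when $P$ satisfies the chain rule defining $P^*$.
\<close>

section \<open>Gibbs' inequality with its equality case\<close>

text \<open>This is \<open>ln t \<le> t - 1\<close> at \<open>t = q / p\<close>, scaled by
  \<open>p\<close>; that bound is tight only at \<open>t = 1\<close>.\<close>

lemma ln_ratio_ge_diff:
  fixes p q :: real
  assumes "p > 0" "q > 0"
  shows "p * (ln p - ln q) \<ge> p - q"
    and "p * (ln p - ln q) = p - q \<Longrightarrow> p = q"
proof -
  have ln: "ln p - ln q = - ln (q / p)"
    using assms by (simp add: ln_div)
  have "p * ln (q / p) \<le> p * (q / p - 1)"
    using assms by (intro mult_left_mono ln_le_minus_one) auto
  also have "\<dots> = q - p"
    using assms by (simp add: right_diff_distrib)
  finally show "p * (ln p - ln q) \<ge> p - q"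
    unfolding ln by simp
  assume "p * (ln p - ln q) = p - q"
  then have "p * ln (q / p) = q - p"
    unfolding ln by simp
  then have "ln (q / p) = (q - p) / p"
    using assms by (simp add: nonzero_eq_divide_eq mult.commute)
  then have "ln (q / p) = q / p - 1"
    using assms by (simp add: diff_divide_distrib)
  then have "q / p = 1"
    using assms by (intro ln_eq_minus_one) auto
  then show "p = q"
    using assms by simp
qed

text \<open>The relative entropy splits into pointwise gaps on the support of \<open>p\<close> and
  the mass of \<open>q\<close> off that support, all nonnegative; if it vanishes, each of them does.
  Positivity of \<open>q\<close> is asked on the support of \<open>p\<close> only, since the
  reference weights used later vanish at tuples whose prefix has probability 0.\<close>

lemma relative_entropy_pmf:
  fixes q :: "'a \<Rightarrow> real"
  assumes fin: "finite A" and supp: "set_pmf p \<subseteq> A"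
    and nonneg: "\<And>x. x \<in> A \<Longrightarrow> q x \<ge> 0"
    and pos: "\<And>x. x \<in> set_pmf p \<Longrightarrow> q x > 0"
    and total: "sum q A = 1"
  shows "measure_pmf.expectation p (\<lambda>x. ln (pmf p x) - ln (q x)) \<ge> 0"
    and "measure_pmf.expectation p (\<lambda>x. ln (pmf p x) - ln (q x)) = 0 \<Longrightarrow> x \<in> A \<Longrightarrow> pmf p x = q x"
proof -
  let ?S = "set_pmf p"
  let ?E = "measure_pmf.expectation p (\<lambda>x. ln (pmf p x) - ln (q x))"
  let ?t = "\<lambda>x. pmf p x * (ln (pmf p x) - ln (q x))"
  have finS: "finite ?S"
    using fin supp by (rule rev_finite_subset)
  have E: "?E = sum ?t ?S"
    by (subst integral_measure_pmf_real[OF finS]) (auto simp: mult.commute)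
  have t: "?t x \<ge> pmf p x - q x" if "x \<in> ?S" for x
    using that pos by (intro ln_ratio_ge_diff(1)) (auto simp: pmf_positive)
  have one: "sum (pmf p) ?S = 1"
    by (rule sum_pmf_eq_1[OF finS]) simp
  have qS: "sum q ?S + sum q (A - ?S) = 1"
    using sum.subset_diff[OF supp fin, of q] total by simp
  have qc: "sum q (A - ?S) \<ge> 0"
    using nonneg by (intro sum_nonneg) auto
  \<comment> \<open>Both masses are 1, so \<open>p - q\<close> sums over the support to the mass
    that \<open>q\<close> puts elsewhere.\<close>
  have split: "?E = (\<Sum>x\<in>?S. ?t x - (pmf p x - q x)) + sum q (A - ?S)"
    using one qS by (simp add: E sum_subtractf)
  have gap: "(\<Sum>x\<in>?S. ?t x - (pmf p x - q x)) \<ge> 0"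
    using t by (intro sum_nonneg) simp
  show "?E \<ge> 0"
    using split gap qc by simp
  assume 0: "?E = 0" and x: "x \<in> A"
  show "pmf p x = q x"
  proof (cases "x \<in> ?S")
    case True
    have "(\<Sum>x\<in>?S. ?t x - (pmf p x - q x)) = 0"
      using split gap qc 0 by simp
    then have "?t x - (pmf p x - q x) = 0"
      using sum_nonneg_eq_0_iff[OF finS, of "\<lambda>x. ?t x - (pmf p x - q x)"] t True by simp
    then show ?thesis
      by (intro ln_ratio_ge_diff(2)[OF pmf_positive[OF True] pos[OF True]]) simp
  next
    case False
    have "sum q (A - ?S) = 0"
      using split gap qc 0 by simp
    then have "q x = 0"
      using sum_nonneg_eq_0_iff[of "A - ?S" q] fin nonneg x False by simp
    with False show ?thesis
      by (simp add: set_pmf_eq)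
  qed
qed

section \<open>Entropy and summation by parts\<close>

lemma shannon_entropy_expectation:
  assumes "finite (set_pmf p)"
  shows "shannon_entropy p = - measure_pmf.expectation p (\<lambda>x. ln (pmf p x))"
  unfolding shannon_entropy_def
  by (subst integral_measure_pmf_real[OF assms]) (auto simp: mult.commute)

text \<open>For \<open>h k\<close> the entropy of the first \<open>k\<close> weights, the increments
  are conditional entropies. The lower boundary term is removed by \<open>h 0 = 0\<close>; the upper
  one will be removed by \<open>lam (d + 1) = 0\<close>.\<close>

lemma sum_by_parts_weights:
  fixes a h :: "nat \<Rightarrow> real"
  assumes "h 0 = 0"
  shows "(\<Sum>k=1..d. (a k - a (k + 1)) * h k)
    = (\<Sum>k=1..d. a k * (h k - h (k - 1))) - a (d + 1) * h d"
proof (induction d)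
  case 0
  show ?case using assms by simp
next
  case (Suc d)
  have "(\<Sum>k=1..Suc d. (a k - a (k + 1)) * h k)
      = (\<Sum>k=1..d. (a k - a (k + 1)) * h k) + (a (Suc d) - a (Suc d + 1)) * h (Suc d)"
    by simp
  also have "\<dots> = (\<Sum>k=1..d. a k * (h k - h (k - 1)))
      + a (Suc d) * (h (Suc d) - h d) - a (Suc d + 1) * h (Suc d)"
    unfolding Suc.IH by (simp add: left_diff_distrib right_diff_distrib)
  finally show ?case by simp
qed

section \<open>Prefixes of tuples and prefix marginals\<close>

lemma sum_tuples_Suc:
  "sum g (tuples (Suc k) W) = (\<Sum>v\<in>tuples k W. \<Sum>a\<in>W (Suc k). g (v(Suc k := a)))"
proof -
  have eq: "tuples (Suc k) W = (\<lambda>(a, v). v(Suc k := a)) ` (W (Suc k) \<times> tuples k W)"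
    unfolding tuples_def atLeastAtMostSuc_conv[of 1 k, OF le_add1[of 1 k, unfolded plus_1_eq_Suc]]
    by (rule PiE_insert_eq)
  have inj: "inj_on (\<lambda>(a, v). v(Suc k := a)) (W (Suc k) \<times> tuples k W)"
    unfolding tuples_def by (rule inj_combinator) simp
  have "sum g (tuples (Suc k) W) = (\<Sum>(a, v)\<in>W (Suc k) \<times> tuples k W. g (v(Suc k := a)))"
    unfolding eq by (subst sum.reindex[OF inj]) (simp add: case_prod_unfold comp_def)
  also have "\<dots> = (\<Sum>a\<in>W (Suc k). \<Sum>v\<in>tuples k W. g (v(Suc k := a)))"
    by (rule sum.cartesian_product[symmetric])
  finally show ?thesis
    by (subst sum.swap)
qed

lemma restrict_tuples: "w \<in> tuples k W \<Longrightarrow> restrict w {1..k} = w"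
  unfolding tuples_def by (rule PiE_restrict)

lemma restrict_tuples_in: "w \<in> tuples d W \<Longrightarrow> k \<le> d \<Longrightarrow> restrict w {1..k} \<in> tuples k W"
  by (auto simp: tuples_def PiE_iff)

text \<open>Members of \<open>tuples k W\<close> are \<open>undefined\<close> off
  \<open>{1..k}\<close>, so restriction undoes the update exactly, not merely up to agreement on
  \<open>{1..k}\<close>.\<close>

lemma restrict_upd_tuples:
  assumes "v \<in> tuples k W"
  shows "restrict (v(Suc k := a)) {1..k} = v"
proof -
  have "restrict (v(Suc k := a)) {1..k} = restrict v {1..k}"
    by (rule restrict_ext) simp
  then show ?thesis
    using restrict_tuples[OF assms] by simp
qed

lemma upd_tuples: "v \<in> tuples k W \<Longrightarrow> a \<in> W (Suc k) \<Longrightarrow> v(Suc k := a) \<in> tuples (Suc k) W"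
  by (auto simp: tuples_def PiE_iff extensional_def)

lemma set_prefix_pmf:
  assumes "set_pmf P \<subseteq> tuples d W" "k \<le> d"
  shows "set_pmf (prefix_pmf k P) \<subseteq> tuples k W"
  using assms restrict_tuples_in[of _ d W k] by (auto simp: prefix_pmf_def)

lemma prefix_pmf_full:
  assumes "set_pmf P \<subseteq> tuples d W"
  shows "prefix_pmf d P = P"
proof -
  have "prefix_pmf d P = map_pmf (\<lambda>w. w) P"
    unfolding prefix_pmf_def
    using assms restrict_tuples[of _ d W] by (intro map_pmf_cong) auto
  then show ?thesis by simp
qed

text \<open>The only empty prefix is the function that is \<open>undefined\<close> everywhere. Its
  point mass has entropy 0, the boundary value for the summation by parts.\<close>

lemma prefix_pmf_0: "prefix_pmf 0 P = return_pmf (\<lambda>_. undefined)"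
  by (simp add: prefix_pmf_def restrict_def)

lemma shannon_entropy_return: "shannon_entropy (return_pmf x) = 0"
  by (simp add: shannon_entropy_def)

lemma prefix_prefix_pmf:
  fixes P :: "(nat \<Rightarrow> 'w) pmf"
  assumes "k \<le> m"
  shows "prefix_pmf k (prefix_pmf m P) = prefix_pmf k P"
proof -
  have "restrict (restrict w {1..m}) {1..k} = restrict w {1..k}" for w :: "nat \<Rightarrow> 'w"
    using assms by (auto simp: restrict_def)
  then show ?thesis
    unfolding prefix_pmf_def map_pmf_comp by (simp only:)
qed

section \<open>The objective as a weighted sum of divergences\<close>

locale gibbs_hierarchy =
  fixes d :: nat and W :: "nat \<Rightarrow> 'w set" and lam :: "nat \<Rightarrow> real"
    and L :: "nat \<Rightarrow> (nat \<Rightarrow> 'w) \<Rightarrow> real"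
  assumes finite_W: "k \<in> {1..d} \<Longrightarrow> finite (W k)"
    and W_nonempty: "k \<in> {1..d} \<Longrightarrow> W k \<noteq> {}"
    and lam_pos: "k \<in> {1..d} \<Longrightarrow> lam k > 0"
    and lam_end: "lam (d + 1) = 0"
    and loss_prefix: "(\<And>j. 1 \<le> j \<Longrightarrow> j \<le> k \<Longrightarrow> w j = w' j) \<Longrightarrow> L k w = L k w'"
begin

lemma finite_tuples: "k \<le> d \<Longrightarrow> finite (tuples k W)"
  unfolding tuples_def using finite_W by (intro finite_PiE) auto

lemma partition_pos:
  assumes "k \<in> {1..d}"
  shows "(\<Sum>a\<in>W k. exp (- L k (w(k := a)) / lam k)) > 0"
  using finite_W[OF assms] W_nonempty[OF assms] by (intro sum_pos) auto

lemma gibbs_cond_pos: "k \<in> {1..d} \<Longrightarrow> gibbs_cond W lam L k w > 0"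
  unfolding gibbs_cond_def by (intro divide_pos_pos partition_pos) auto

lemma gibbs_cond_prefix:
  assumes "\<And>j. 1 \<le> j \<Longrightarrow> j \<le> k \<Longrightarrow> w j = w' j"
  shows "gibbs_cond W lam L k w = gibbs_cond W lam L k w'"
proof -
  have "L k w = L k w'"
    by (rule loss_prefix) (rule assms)
  moreover have "L k (w(k := a)) = L k (w'(k := a))" for a
    by (rule loss_prefix) (use assms in auto)
  ultimately show ?thesis
    by (simp add: gibbs_cond_def)
qed

text \<open>The sum inside the soft loss is the normaliser of the Gibbs conditional. The averaging
  factor in front of it contributes only a term that is constant in \<open>w\<close>.\<close>

lemma loss_minus_soft_loss:
  assumes "k \<in> {1..d}"
  shows "L k w - soft_loss W lam L k w
    = - lam k * ln (gibbs_cond W lam L k w) - lam k * ln (card (W k))"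
proof -
  let ?Z = "\<Sum>a\<in>W k. exp (- L k (w(k := a)) / lam k)"
  have Z: "?Z > 0"
    by (rule partition_pos[OF assms])
  have c: "real (card (W k)) > 0"
    using finite_W[OF assms] W_nonempty[OF assms] by (simp add: card_gt_0_iff)
  have g: "ln (gibbs_cond W lam L k w) = - L k w / lam k - ln ?Z"
    unfolding gibbs_cond_def using Z by (subst ln_div) auto
  have s: "ln (1 / real (card (W k)) * ?Z) = ln ?Z - ln (card (W k))"
    using Z c by (simp add: ln_div)
  show ?thesis
    unfolding soft_loss_def g s using lam_pos[OF assms] by (simp add: field_simps)
qed

text \<open>For \<open>k\<close> in \<open>{1..d}\<close> and \<open>P\<close> supported on the
  tuples, this is the conditional relative entropy of level \<open>k\<close> given its prefix.
  Taking the expectation under the full \<open>P\<close>, with separate logarithms, puts all levels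
  on one measure and exposes the two entropies.\<close>

definition chain_divergence :: "(nat \<Rightarrow> 'w) pmf \<Rightarrow> nat \<Rightarrow> real" where
  "chain_divergence P k = measure_pmf.expectation P
     (\<lambda>w. ln (pmf (prefix_pmf k P) (restrict w {1..k}))
        - ln (pmf (prefix_pmf (k - 1) P) (restrict w {1..k - 1}))
        - ln (gibbs_cond W lam L k w))"

text \<open>After summation by parts, \<open>lam k\<close> multiplies the expected negative log
  conditional minus an entropy increment, which is the divergence at level \<open>k\<close>. The
  remaining sum is the same for every \<open>P\<close>.\<close>

lemma objective_eq_divergences:
  assumes supp: "set_pmf P \<subseteq> tuples d W"
  shows "multiscale_objective d W lam L P
    = (\<Sum>k=1..d. lam k * chain_divergence P k) - (\<Sum>k=1..d. lam k * ln (card (W k)))"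
proof -
  have finP: "finite (set_pmf P)"
    using finite_tuples supp by (blast intro: finite_subset)
  note int[simp, intro] = integrable_measure_pmf_finite[OF finP, where 'b = real]
  let ?E = "measure_pmf.expectation P"
  let ?h = "\<lambda>k. shannon_entropy (prefix_pmf k P)"
  let ?g = "\<lambda>k w. ln (gibbs_cond W lam L k w)"
  have ent: "?h k = - ?E (\<lambda>w. ln (pmf (prefix_pmf k P) (restrict w {1..k})))" for k
  proof -
    have "finite (set_pmf (prefix_pmf k P))"
      using finP by (simp add: prefix_pmf_def)
    then have "?h k = - measure_pmf.expectation (prefix_pmf k P) (\<lambda>x. ln (pmf (prefix_pmf k P) x))"
      by (rule shannon_entropy_expectation)
    also have "measure_pmf.expectation (prefix_pmf k P) (\<lambda>x. ln (pmf (prefix_pmf k P) x))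
      = ?E (\<lambda>w. ln (pmf (prefix_pmf k P) (restrict w {1..k})))"
      unfolding prefix_pmf_def by (rule integral_map_pmf)
    finally show ?thesis .
  qed
  have div: "chain_divergence P k = ?h (k - 1) - ?h k - ?E (?g k)" for k
    unfolding chain_divergence_def ent by simp
  have "?E (multiscale_loss d W lam L)
      = ?E (\<lambda>w. \<Sum>k=1..d. - lam k * ?g k w - lam k * ln (card (W k)))"
    unfolding multiscale_loss_def
    by (intro Bochner_Integration.integral_cong sum.cong loss_minus_soft_loss) auto
  also have "\<dots> = (\<Sum>k=1..d. ?E (\<lambda>w. - lam k * ?g k w - lam k * ln (card (W k))))"
    by (rule Bochner_Integration.integral_sum) simp
  also have "\<dots> = (\<Sum>k=1..d. - lam k * ?E (?g k) - lam k * ln (card (W k)))"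
    by (intro sum.cong refl) simp
  finally have loss: "?E (multiscale_loss d W lam L)
      = (\<Sum>k=1..d. - lam k * ?E (?g k) - lam k * ln (card (W k)))" .
  have parts: "(\<Sum>k=1..d. (lam k - lam (k + 1)) * ?h k) = (\<Sum>k=1..d. lam k * (?h k - ?h (k - 1)))"
    using sum_by_parts_weights[of ?h lam d] lam_end
    by (simp add: prefix_pmf_0 shannon_entropy_return)
  show ?thesis
    unfolding multiscale_objective_def loss parts div sum_subtractf[symmetric]
    by (intro sum.cong refl) (simp add: algebra_simps)
qed

text \<open>Gibbs' inequality on \<open>tuples (Suc k) W\<close>, with reference weight
  \<open>q\<close> extending the \<open>k\<close>-marginal of \<open>P\<close> by the Gibbs
  conditional. Its equality case is one link of the chain rule.\<close>

lemma chain_divergence_Suc: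
  assumes supp: "set_pmf P \<subseteq> tuples d W" and k: "k < d"
  shows "chain_divergence P (Suc k) \<ge> 0"
    and "chain_divergence P (Suc k) = 0 \<Longrightarrow> v \<in> tuples (Suc k) W \<Longrightarrow>
      pmf (prefix_pmf (Suc k) P) v
        = pmf (prefix_pmf k P) (restrict v {1..k}) * gibbs_cond W lam L (Suc k) v"
proof -
  let ?p = "prefix_pmf (Suc k) P"
  let ?g = "gibbs_cond W lam L (Suc k)"
  define q where "q v = pmf (prefix_pmf k P) (restrict v {1..k}) * ?g v" for v
  have g: "?g w > 0" for w
    using k by (intro gibbs_cond_pos) auto
  have fin: "finite (tuples (Suc k) W)"
    using k by (intro finite_tuples) simp
  have sp: "set_pmf ?p \<subseteq> tuples (Suc k) W"
    using supp k by (intro set_prefix_pmf) auto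
  have p: "prefix_pmf k P = map_pmf (\<lambda>v. restrict v {1..k}) ?p"
    using prefix_prefix_pmf[of k "Suc k" P] by (simp add: prefix_pmf_def[of k ?p])
  have pos: "pmf (prefix_pmf k P) (restrict v {1..k}) > 0" if "v \<in> set_pmf ?p" for v
    using that unfolding p by (intro pmf_positive) auto
  \<comment> \<open>Summing over the last coordinate first, the conditional gives 1 and the mass of
    the prefix marginal remains.\<close>
  have "sum q (tuples (Suc k) W)
      = (\<Sum>v\<in>tuples k W. \<Sum>a\<in>W (Suc k). pmf (prefix_pmf k P) v * ?g (v(Suc k := a)))"
    unfolding sum_tuples_Suc q_def by (intro sum.cong refl) (simp only: restrict_upd_tuples)
  also have "\<dots> = (\<Sum>v\<in>tuples k W. pmf (prefix_pmf k P) v)"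
    using gibbs_cond_sum[of W "Suc k"] finite_W W_nonempty k by (simp flip: sum_distrib_left)
  also have "\<dots> = 1"
    using finite_tuples set_prefix_pmf[OF supp] k by (intro sum_pmf_eq_1) auto
  finally have total: "sum q (tuples (Suc k) W) = 1" .
  \<comment> \<open>The logarithm of \<open>q\<close> splits only where the prefix has positive
    mass, so the integrands are compared almost everywhere.\<close>
  have "chain_divergence P (Suc k) = measure_pmf.expectation P
      (\<lambda>w. ln (pmf ?p (restrict w {1..Suc k})) - ln (q (restrict w {1..Suc k})))"
    unfolding chain_divergence_def
  proof (rule integral_cong_AE)
    show "AE w in P. ln (pmf ?p (restrict w {1..Suc k}))
        - ln (pmf (prefix_pmf (Suc k - 1) P) (restrict w {1..Suc k - 1})) - ln (?g w)
      = ln (pmf ?p (restrict w {1..Suc k})) - ln (q (restrict w {1..Suc k}))"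
    proof (rule AE_pmfI)
      fix w assume w: "w \<in> set_pmf P"
      let ?v = "restrict w {1..Suc k}"
      have "?v \<in> set_pmf ?p"
        using w by (simp add: prefix_pmf_def)
      then have "ln (q ?v) = ln (pmf (prefix_pmf k P) (restrict ?v {1..k})) + ln (?g ?v)"
        unfolding q_def using g[of ?v] pos[of ?v] by (subst ln_mult) auto
      moreover have "restrict ?v {1..k} = restrict w {1..k}"
        by (auto simp: restrict_def)
      moreover have "?g ?v = ?g w"
        by (rule gibbs_cond_prefix) simp
      ultimately show "ln (pmf ?p ?v)
          - ln (pmf (prefix_pmf (Suc k - 1) P) (restrict w {1..Suc k - 1})) - ln (?g w)
        = ln (pmf ?p ?v) - ln (q ?v)"
        by simp
    qed
  qed simp_all
  also have "\<dots> = measure_pmf.expectation ?p (\<lambda>v. ln (pmf ?p v) - ln (q v))"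
    unfolding prefix_pmf_def by (rule integral_map_pmf[symmetric])
  finally have D: "chain_divergence P (Suc k)
      = measure_pmf.expectation ?p (\<lambda>v. ln (pmf ?p v) - ln (q v))" .
  have qn: "q v \<ge> 0" for v
    using g[of v] by (simp add: q_def)
  have qp: "q v > 0" if "v \<in> set_pmf ?p" for v
    using g[of v] pos[OF that] by (simp add: q_def)
  show "chain_divergence P (Suc k) \<ge> 0"
    unfolding D by (rule relative_entropy_pmf(1)[OF fin sp qn _ total]) (rule qp)
  show "pmf ?p v = pmf (prefix_pmf k P) (restrict v {1..k}) * ?g v"
    if "chain_divergence P (Suc k) = 0" "v \<in> tuples (Suc k) W"
    using relative_entropy_pmf(2)[OF fin sp qn _ total that(1)[unfolded D] that(2)] qp
    by (simp add: q_def)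
qed

section \<open>Vanishing divergences characterise the Gibbs distribution\<close>

lemma pmf_gibbs_hierarchy:
  "pmf (gibbs d W lam L) w = (if w \<in> tuples d W then \<Prod>k=1..d. gibbs_cond W lam L k w else 0)"
  by (rule pmf_gibbs) (fact finite_W W_nonempty loss_prefix)+

lemma set_gibbs: "set_pmf (gibbs d W lam L) \<subseteq> tuples d W"
  by (auto simp: set_pmf_eq pmf_gibbs_hierarchy)

text \<open>The links of the chain rule multiply up from the empty prefix; at \<open>k = d\<close>
  the marginal is \<open>P\<close> itself. Off the tuples both mass functions are 0.\<close>

lemma eq_gibbs_if_divergences_0:
  assumes supp: "set_pmf P \<subseteq> tuples d W"
    and zero: "\<And>k. k \<in> {1..d} \<Longrightarrow> chain_divergence P k = 0"
  shows "P = gibbs d W lam L"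
proof -
  have marginal: "pmf (prefix_pmf k P) v = (\<Prod>j=1..k. gibbs_cond W lam L j v)"
    if "k \<le> d" "v \<in> tuples k W" for k v
    using that
  proof (induction k arbitrary: v)
    case 0
    then show ?case
      by (simp add: prefix_pmf_0 tuples_def)
  next
    case (Suc k)
    let ?u = "restrict v {1..k}"
    have "pmf (prefix_pmf (Suc k) P) v
        = pmf (prefix_pmf k P) ?u * gibbs_cond W lam L (Suc k) v"
      using Suc.prems zero by (intro chain_divergence_Suc[OF supp]) auto
    also have "pmf (prefix_pmf k P) ?u = (\<Prod>j=1..k. gibbs_cond W lam L j ?u)"
    proof (rule Suc.IH)
      show "?u \<in> tuples k W"
        using Suc.prems(2) by (rule restrict_tuples_in) simp
    qed (use Suc.prems in simp)
    also have "\<dots> = (\<Prod>j=1..k. gibbs_cond W lam L j v)"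
      by (intro prod.cong refl gibbs_cond_prefix) simp
    finally show ?case
      by simp
  qed
  show ?thesis
  proof (rule pmf_eqI)
    fix w
    show "pmf P w = pmf (gibbs d W lam L) w"
      using marginal[of d w] supp
      by (auto simp: prefix_pmf_full[OF supp] pmf_gibbs_hierarchy set_pmf_eq)
  qed
qed

text \<open>Among the tuples of length \<open>Suc k\<close>, the fibre of restriction over
  \<open>v\<close> consists of the extensions \<open>v(Suc k := a)\<close>.\<close>

lemma pmf_prefix_Suc:
  assumes supp: "set_pmf P \<subseteq> tuples d W" and k: "k < d" and v: "v \<in> tuples k W"
  shows "pmf (prefix_pmf k P) v = (\<Sum>a\<in>W (Suc k). pmf (prefix_pmf (Suc k) P) (v(Suc k := a)))"
proof -
  let ?p = "prefix_pmf (Suc k) P"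
  let ?r = "\<lambda>u :: nat \<Rightarrow> 'w. restrict u {1..k}"
  have sp: "set_pmf ?p \<subseteq> tuples (Suc k) W"
    using supp k by (intro set_prefix_pmf) auto
  have fin: "finite (tuples (Suc k) W)"
    using k by (intro finite_tuples) simp
  have "pmf (prefix_pmf k P) v = pmf (map_pmf ?r ?p) v"
    using prefix_prefix_pmf[of k "Suc k" P] by (simp add: prefix_pmf_def[of k ?p])
  \<comment> \<open>Writing the point mass as an expectation allows a change of variables to the
    longer prefix.\<close>
  also have "\<dots> = measure_pmf.expectation (map_pmf ?r ?p) (indicator {v})"
    by (simp add: pmf.rep_eq)
  also have "\<dots> = measure_pmf.expectation ?p (\<lambda>u. indicator {v} (?r u))"
    by (rule integral_map_pmf)
  also have "\<dots> = (\<Sum>u\<in>tuples (Suc k) W. indicator {v} (?r u) * pmf ?p u)"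
    by (rule integral_measure_pmf_real[OF fin]) (use sp in auto)
  also have "\<dots> = (\<Sum>u\<in>tuples k W. \<Sum>a\<in>W (Suc k). indicator {v} u * pmf ?p (u(Suc k := a)))"
    unfolding sum_tuples_Suc by (intro sum.cong refl) (simp only: restrict_upd_tuples)
  also have "\<dots> = (\<Sum>u\<in>tuples k W. if u = v then \<Sum>a\<in>W (Suc k). pmf ?p (u(Suc k := a)) else 0)"
    by (intro sum.cong) (auto simp: indicator_def)
  also have "\<dots> = (\<Sum>a\<in>W (Suc k). pmf ?p (v(Suc k := a)))"
    using finite_tuples[of k] k v by simp
  finally show ?thesis .
qed

text \<open>The induction runs downward from \<open>d\<close>, where the product is the definition.
  Summing out coordinate \<open>Suc k\<close> deletes the last factor: the earlier factors do not
  see it, and the conditional sums to 1.\<close>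

lemma prefix_gibbs:
  assumes "k \<le> d" "v \<in> tuples k W"
  shows "pmf (prefix_pmf k (gibbs d W lam L)) v = (\<Prod>j=1..k. gibbs_cond W lam L j v)"
  using assms
proof (induction k arbitrary: v rule: inc_induct)
  case base
  then show ?case
    by (simp add: prefix_pmf_full[OF set_gibbs] pmf_gibbs_hierarchy)
next
  case (step k)
  let ?g = "gibbs_cond W lam L"
  have g: "?g j (v(Suc k := a)) = ?g j v" if "j \<in> {1..k}" for j a
    by (rule gibbs_cond_prefix) (use that in auto)
  have "pmf (prefix_pmf k (gibbs d W lam L)) v
      = (\<Sum>a\<in>W (Suc k). pmf (prefix_pmf (Suc k) (gibbs d W lam L)) (v(Suc k := a)))"
    using step by (intro pmf_prefix_Suc set_gibbs) auto
  also have "\<dots> = (\<Sum>a\<in>W (Suc k). (\<Prod>j=1..k. ?g j v) * ?g (Suc k) (v(Suc k := a)))"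
  proof (intro sum.cong refl)
    fix a assume "a \<in> W (Suc k)"
    with step.prems have "v(Suc k := a) \<in> tuples (Suc k) W"
      by (rule upd_tuples)
    then have "pmf (prefix_pmf (Suc k) (gibbs d W lam L)) (v(Suc k := a))
        = (\<Prod>j=1..Suc k. ?g j (v(Suc k := a)))"
      by (rule step.IH)
    also have "\<dots> = (\<Prod>j=1..k. ?g j v) * ?g (Suc k) (v(Suc k := a))"
      by (simp add: g)
    finally show "pmf (prefix_pmf (Suc k) (gibbs d W lam L)) (v(Suc k := a))
        = (\<Prod>j=1..k. ?g j v) * ?g (Suc k) (v(Suc k := a))" .
  qed
  also have "\<dots> = (\<Prod>j=1..k. ?g j v)"
    using gibbs_cond_sum[of W "Suc k"] finite_W W_nonempty step.hyps
    by (simp flip: sum_distrib_left)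
  finally show ?case .
qed

text \<open>On the support, the log marginals at \<open>k\<close> and \<open>k - 1\<close> are
  partial sums of log conditionals, so they differ by exactly the term at \<open>k\<close>.\<close>

lemma chain_divergence_gibbs:
  assumes k: "k \<in> {1..d}"
  shows "chain_divergence (gibbs d W lam L) k = 0"
proof -
  let ?G = "gibbs d W lam L"
  let ?g = "gibbs_cond W lam L"
  have log: "ln (pmf (prefix_pmf m ?G) (restrict w {1..m})) = (\<Sum>j=1..m. ln (?g j w))"
    if w: "w \<in> tuples d W" and m: "m \<le> d" for w m
  proof -
    have "pmf (prefix_pmf m ?G) (restrict w {1..m}) = (\<Prod>j=1..m. ?g j (restrict w {1..m}))"
      using m restrict_tuples_in[OF w m] by (rule prefix_gibbs)
    also have "\<dots> = (\<Prod>j=1..m. ?g j w)"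
      by (intro prod.cong refl gibbs_cond_prefix) simp
    also have "ln \<dots> = (\<Sum>j=1..m. ln (?g j w))"
    proof (rule ln_prod)
      show "?g j w \<noteq> 0" if "j \<in> {1..m}" for j
        using gibbs_cond_pos[of j w] that m by simp
    qed simp
    finally show ?thesis .
  qed
  obtain m where m: "k = Suc m"
    using k by (cases k) auto
  have "chain_divergence ?G k = measure_pmf.expectation ?G (\<lambda>w. 0)"
    unfolding chain_divergence_def
  proof (rule integral_cong_AE)
    show "AE w in ?G. ln (pmf (prefix_pmf k ?G) (restrict w {1..k}))
        - ln (pmf (prefix_pmf (k - 1) ?G) (restrict w {1..k - 1})) - ln (?g k w) = 0"
    proof (rule AE_pmfI)
      fix w assume "w \<in> set_pmf ?G"
      then have w: "w \<in> tuples d W"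
        using set_gibbs by blast
      show "ln (pmf (prefix_pmf k ?G) (restrict w {1..k}))
        - ln (pmf (prefix_pmf (k - 1) ?G) (restrict w {1..k - 1})) - ln (?g k w) = 0"
        using log[OF w, of k] log[OF w, of m] k m by simp
    qed
  qed simp_all
  then show ?thesis by simp
qed

section \<open>Existence and uniqueness of the minimiser\<close>

lemma arg_min_multiscale_objective:
  "{P. is_arg_min (multiscale_objective d W lam L) (\<lambda>P. set_pmf P \<subseteq> tuples d W) P}
    = {gibbs d W lam L}"
proof -
  let ?G = "gibbs d W lam L"
  let ?obj = "multiscale_objective d W lam L"
  have nonneg: "lam k * chain_divergence P k \<ge> 0"
    if "set_pmf P \<subseteq> tuples d W" "k \<in> {1..d}" for P k
    using chain_divergence_Suc(1)[OF that(1), of "k - 1"] lam_pos[of k] that(2)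
    by (intro mult_nonneg_nonneg) auto
  have sum_nn: "(\<Sum>k=1..d. lam k * chain_divergence P k) \<ge> 0" if "set_pmf P \<subseteq> tuples d W" for P
    using nonneg[OF that] by (intro sum_nonneg)
  have min: "?obj ?G \<le> ?obj P" if P: "set_pmf P \<subseteq> tuples d W" for P
    using sum_nn[OF P]
    by (simp add: objective_eq_divergences[OF P] objective_eq_divergences[OF set_gibbs]
        chain_divergence_gibbs)
  \<comment> \<open>A value no larger than that of \<open>?G\<close> forces a sum of nonnegative
    terms to be at most 0; as each \<open>lam k\<close> is positive, every divergence
    vanishes.\<close>
  have unique: "P = ?G" if P: "set_pmf P \<subseteq> tuples d W" and le: "?obj P \<le> ?obj ?G" for P
  proof (rule eq_gibbs_if_divergences_0[OF P])
    fix k assume k: "k \<in> {1..d}"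
    have "(\<Sum>k=1..d. lam k * chain_divergence P k) \<le> 0"
      using le by (simp add: objective_eq_divergences[OF P] objective_eq_divergences[OF set_gibbs]
          chain_divergence_gibbs)
    then have "(\<Sum>k=1..d. lam k * chain_divergence P k) = 0"
      using sum_nn[OF P] by (intro antisym) auto
    then have "lam k * chain_divergence P k = 0"
      using sum_nonneg_eq_0_iff[of "{1..d}" "\<lambda>k. lam k * chain_divergence P k"] nonneg[OF P] k
      by simp
    then show "chain_divergence P k = 0"
      using lam_pos[OF k] by simp
  qed
  show ?thesis
    using min unique set_gibbs by (auto simp: is_arg_min_linorder)
qed

end

theorem theorem2:
  fixes \<epsilon> \<beta> M1 M2 :: real
    and d n :: nat
    and f :: "real \<Rightarrow> real"
    and W :: "nat \<Rightarrow> 'w set"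
    and F :: "nat \<Rightarrow> real \<Rightarrow> 'w \<Rightarrow> real"
    and lam :: "nat \<Rightarrow> real"
    and s :: "nat \<Rightarrow> real"
  defines "L \<equiv> sample_loss \<epsilon> \<beta> d f F n s"
  assumes "d \<ge> 1" and "\<epsilon> > 0" and "\<beta> > 1"
    and "f 0 = 0"
    and "diffeomorphism_on M1 M2 {- radius \<epsilon> \<beta> d <..< radius \<epsilon> \<beta> d} f"
    and "\<And>k. k \<in> {1..d} \<Longrightarrow> finite (W k)"
    and "\<And>k. k \<in> {1..d} \<Longrightarrow> W k \<noteq> {}"
    and "\<And>k. k \<in> {1..d} \<Longrightarrow> lam k > 0"
    and "lam (d + 1) = 0"
    and "n \<ge> 1"
    and "\<And>i. i \<in> {1..n} \<Longrightarrow> s i \<in> instance_space \<epsilon> \<beta> d"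
  shows "{P. is_arg_min (multiscale_objective d W lam L) (\<lambda>P. set_pmf P \<subseteq> tuples d W) P}
         = {gibbs d W lam L}"
proof -
  interpret gibbs_hierarchy d W lam L
  proof
    \<comment> \<open>Causality of the hierarchy: level \<open>k\<close> is computed from the first
      \<open>k\<close> weights.\<close>
    show "L k w = L k w'" if "\<And>j. 1 \<le> j \<Longrightarrow> j \<le> k \<Longrightarrow> w j = w' j" for k w w'
      unfolding L_def by (rule sample_loss_prefix) (rule that)
  qed (use assms in auto)
  show ?thesis
    by (rule arg_min_multiscale_objective)
qed

end
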